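(* Let $b>0$, let $p\geq 2$ be an integer, and let $X_{1},\ldots,X_{n}$ be independent random variables with $\mathbb{P}(X_i\in(-\infty,b])=1$ and $X_{i}\in L^{p}$ for all $i=1,\ldots,n$. Let $S_{n}=\sum_{i=1}^{n}X_{i}$. Let $\mu_i^1=\mathbb{E}(X_{i})$, and let $\mu_i^2,\ldots,\mu_i^p$ be real numbers such that $\mathbb{E}(X_{i}^{k})\leq\mu_{i}^{k}$ for all $k=1,\ldots,p-1$ and $0<\mathbb{E}(\max(X_{i}^{p},0))\leq\mu_{i}^{p}$, for all $i=1,\ldots,n$. Let $\mu^{k}=\sum_{i=1}^{n}\mu_{i}^{k}$ for $k=1,\ldots,p$. For $t>0$ put $$\alpha_{0}=1+\frac{tb^{p-1}}{\mu^{p}}>1,\qquad \alpha_{j}=\frac{b^{p-j-1}\mu^{j+1}}{\mu^{p}j!}-\frac{1}{j!}\quad (j=1,\ldots,p-2),$$ and let $G_{p-2}(\alpha_{0},\ldots,\alpha_{p-2})$ be the (non-empty) set of positive real solutions $x$ of the equation $\alpha_{0}-\sum_{j=1}^{p-2}\alpha_{j}x^{j}=\exp(x)$. (i) For all $t>0$, $$\mathbb{P}(S_{n}-\mathbb{E}(S_{n})\geq t)\leq\exp\left(\max_{y\in G_{p-2}(\alpha_{0},\ldots,\alpha_{p-2})}\left(\frac{t}{b}-\left(\frac{t}{b}+\frac{\mu^{2}}{b^{2}}\right)y+\sum_{j=2}^{p-1}\left(\frac{\mu^{j}}{b^{j}j!}-\frac{\mu^{j+1}}{b^{j+1}j!}\right)y^{j}\right)\right).$$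 (ii) If $\mu^{j}\geq 0$ for every odd number $j$ with $3\leq j\leq p-1$, then $G_{p-2}(\alpha_0,\ldots,\alpha_{p-2})$ consists of one element $y$ and the inequality in (i) reduces to $$\mathbb{P}(S_{n}-\mathbb{E}(S_{n})\geq t)\leq\exp\left(\frac{t}{b}-\left(\frac{t}{b}+\frac{\mu^{2}}{b^{2}}\right)y+\sum_{j=2}^{p-1}\left(\frac{\mu^{j}}{b^{j}j!}-\frac{\mu^{j+1}}{b^{j+1}j!}\right)y^{j}\right),$$ where $y$ is the unique positive solution of $\alpha_{0}-\sum_{j=1}^{p-2}\alpha_{j}x^{j}=\exp(x)$. (iii) Suppose that $p=2$. Then $G_{0}(\alpha_{0})=\{\ln(\alpha_{0})\}$ and the inequality in (i) reduces to Bennett's inequality: $$\mathbb{P}(S_{n}-\mathbb{E}(S_{n})\geq t)\leq\exp\left(\frac{t}{b}-\left(\frac{t}{b}+\frac{\mu^{2}}{b^{2}}\right)\ln\left(\frac{tb}{\mu^{2}}+1\right)\right)=\exp\left(-\frac{\mu^{2}}{b^{2}}\left(\left(\frac{bt}{\mu^{2}}+1\right)\ln\left(\frac{bt}{\mu^{2}}+1\right)-\frac{bt}{\mu^{2}}\right)\right).$$ (iv) Suppose that $p=3$, $\alpha_{1}\neq 0$, and $\mathbb{E}(\max(X_{i}^{3},0))=\mu_{i}^{3}$ for all $i=1,\ldots,n$. Then $G_{1}(\alpha_{0},\alpha_{1})=\left\{\frac{\alpha_{0}}{\alpha_{1}}-W\left(\frac{\exp(\alpha_{0}/\alpha_{1})}{\alpha_{1}}\right)\right\}$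 consists of one element and the inequality in (i) reduces to $$\mathbb{P}(S_{n}-\mathbb{E}(S_{n})\geq t)\leq\exp\left(\frac{t}{b}-\left(\frac{t}{b}+\frac{\mu^{2}}{b^{2}}\right)y+\left(\frac{\mu^{2}}{2b^{2}}-\frac{\mu^{3}}{2b^{3}}\right)y^{2}\right),$$ where $y=\frac{\alpha_{0}}{\alpha_{1}}-W\left(\frac{\exp(\alpha_{0}/\alpha_{1})}{\alpha_{1}}\right)$.
   Context: $L^{p}$ is the space of random variables $X$ with $\mathbb{E}|X|^{p}<\infty$. Superscripts $k$ in $\mu_i^k$ and $\mu^k$ are indices, not powers (whereas $b^k$, $x^k$, $y^k$ are powers). Empty sums are $0$. $W$ is the principal branch of the Lambert $W$-function: for $x\geq 0$, $W(x)$ is the unique real $y \ge 0$ with $y\exp(y)=x$. *)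

theory Defs
  imports "HOL-Probability.Probability"
begin

text \<open>In the following definitions \<open>m k\<close> is the bound on the sum of the moments of order \<open>k\<close>
  (written \<open>\<mu>\<close> with upper index \<open>k\<close>; the index is not a power).\<close>

text \<open>The second branch is intended for \<open>1 \<le> j \<le> p - 2\<close>, where the subtraction on
  natural numbers does not truncate.\<close>

definition alpha :: "nat \<Rightarrow> real \<Rightarrow> (nat \<Rightarrow> real) \<Rightarrow> real \<Rightarrow> nat \<Rightarrow> real" where
  "alpha p b m t j =
     (if j = 0 then 1 + t * b ^ (p - 1) / m p
      else b ^ (p - j - 1) * m (j + 1) / (m p * fact j) - 1 / fact j)"

definition G :: "nat \<Rightarrow> (nat \<Rightarrow> real) \<Rightarrow> real set" where
  "G d a = {x. 0 < x \<and> a 0 - (\<Sum>j = 1..d. a j * x ^ j) = exp x}"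

definition bound_exponent :: "nat \<Rightarrow> real \<Rightarrow> (nat \<Rightarrow> real) \<Rightarrow> real \<Rightarrow> real \<Rightarrow> real" where
  "bound_exponent p b m t y =
     t / b - (t / b + m 2 / b ^ 2) * y
     + (\<Sum>j = 2..p - 1. (m j / (b ^ j * fact j) - m (j + 1) / (b ^ (j + 1) * fact j)) * y ^ j)"

text \<open>The principal branch of the Lambert function, specified on the nonnegative reals only
  (for \<open>x < 0\<close> the value is unspecified); the next lemma shows that it is well defined there.\<close>

definition lambert_W :: "real \<Rightarrow> real" where
  "lambert_W x = (THE y. 0 \<le> y \<and> y * exp y = x)"

lemma lambert_W_unique_exists:
  fixes x :: real
  assumes "0 \<le> x"
  shows "\<exists>!y. 0 \<le> y \<and> y * exp y = x"
proof (rule ex_ex1I)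
  have "x * 1 \<le> x * exp x"
    using assms by (intro mult_left_mono) auto
  then have "\<exists>y\<ge>0. y \<le> x \<and> y * exp y = x"
    using assms by (intro IVT') (auto intro!: continuous_intros)
  then show "\<exists>y. 0 \<le> y \<and> y * exp y = x" by blast
next
  fix y z :: real
  assume y: "0 \<le> y \<and> y * exp y = x" and z: "0 \<le> z \<and> z * exp z = x"
  have less: "u * exp u < v * exp v" if "0 \<le> u" "u < v" for u v :: real
    using that by (intro mult_strict_mono) auto
  show "y = z"
    using less[of y z] less[of z y] y z by (cases y z rule: linorder_cases) auto
qed

end

theory Submission
  imports Defs
begin


text \<open>
  The proof is the Chernoff method with a moment expansion of order \<open>p\<close>. Write
  \<open>T\<^sub>k x = exp x - (\<Sum>j<k. x ^ j / fact j)\<close> for the remainder of the exponential series. On the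
  half-line \<open>z \<le> 1\<close> one has \<open>T\<^sub>p (y * z) \<le> T\<^sub>p y * max (z ^ p) 0\<close> for every \<open>y \<ge> 0\<close>
  (lemma \<open>exp_tail_scale\<close>): for \<open>z \<ge> 0\<close> each term of the series shrinks by at least the factor
  \<open>z ^ p\<close>, and for \<open>z < 0\<close> the Lagrange form of the remainder decides the sign or the size.
  With \<open>z = X / b\<close> this bounds the moment generating function of a variable \<open>X \<le> b\<close> at \<open>y / b\<close> by
  its moments below order \<open>p\<close> and by the mean of \<open>max (X ^ p) 0\<close>. Independence,
  \<open>1 + u \<le> exp u\<close> and Markov's inequality then bound the upper tail of the centred sum by \<open>exp (h y)\<close>
  for every \<open>y > 0\<close>, where
  \<open>h y = - (t / b) * y + (\<Sum>j = 2..p - 1. m j * y ^ j / (b ^ j * fact j)) + m p / b ^ p * T\<^sub>p y\<close>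
  (lemma \<open>upper_tail_le_chernoff_exponent\<close>).

  The set \<open>G\<close> is exactly the set of positive critical points of \<open>h\<close>: the derivative of \<open>h\<close> is a
  positive multiple of \<open>exp y - \<alpha> 0 + (\<Sum>j = 1..p - 2. \<alpha> j * y ^ j)\<close>. At such a point the
  critical equation eliminates \<open>exp y\<close> from \<open>h y\<close> and leaves the stated polynomial exponent
  (lemma \<open>chernoff_exponent_on_G\<close>). Hence the stated bound holds at \<^emph>\<open>every\<close> point of \<open>G\<close>, and
  so at the one with the largest exponent, as soon as \<open>G\<close> is finite and nonempty. That \<open>G\<close> is
  finite follows from Rolle's theorem, that it is nonempty from the intermediate value theorem.

  If the moment bounds \<open>m j\<close> are nonnegative, the derivative of \<open>h\<close> is strictly increasing and \<open>G\<close> is a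
  singleton; for even \<open>j\<close> nonnegativity is automatic. For \<open>p = 2\<close> the critical
  equation is \<open>exp y = \<alpha> 0\<close>; for \<open>p = 3\<close> it is \<open>\<alpha> 0 - \<alpha> 1 * y = exp y\<close>, which \<open>lambert_W\<close> solves
  because \<open>X ^ 3 \<le> b * X ^ 2\<close> forces \<open>\<alpha> 1 \<ge> 0\<close>.
\<close>

section \<open>Remainders of the exponential series\<close>

definition exp_tail :: "nat \<Rightarrow> real \<Rightarrow> real" where
  "exp_tail k x = exp x - (\<Sum>j<k. x ^ j / fact j)"

lemma exp_tail_Suc: "exp_tail (Suc k) x = exp_tail k x - x ^ k / fact k"
  by (simp add: exp_tail_def)

lemma exp_tail_sums: "(\<lambda>j. x ^ (j + k) / fact (j + k)) sums exp_tail k x"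
proof -
  have "(\<lambda>j. x ^ j / fact j) sums exp x"
    using exp_converges[of x] by (simp add: field_simps)
  from sums_split_initial_segment[OF this, of k] show ?thesis
    by (simp add: exp_tail_def)
qed

lemma power_le_exp_tail:
  assumes "0 \<le> y"
  shows "y ^ k / fact k \<le> exp_tail k y"
proof -
  have "sum (\<lambda>j. y ^ (j + k) / fact (j + k)) {0} \<le> (\<Sum>j. y ^ (j + k) / fact (j + k))"
    using assms sums_summable[OF exp_tail_sums[of y k]] by (intro sum_le_suminf) auto
  then show ?thesis
    using sums_unique[OF exp_tail_sums[of y k]] by simp
qed

lemma exp_tail_pos: "0 < y \<Longrightarrow> 0 < exp_tail k y"
  by (rule less_le_trans[OF _ power_le_exp_tail]) auto

lemma exp_tail_scale_unit:
  assumes "0 \<le> y" "0 \<le> z" "z \<le> 1"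
  shows "exp_tail k (y * z) \<le> z ^ k * exp_tail k y"
proof (rule sums_le[OF _ exp_tail_sums sums_mult[OF exp_tail_sums]])
  fix j
  have "z ^ (j + k) \<le> z ^ k"
    using assms by (intro power_decreasing) auto
  then have "y ^ (j + k) * z ^ (j + k) \<le> y ^ (j + k) * z ^ k"
    using assms by (intro mult_left_mono) auto
  then show "(y * z) ^ (j + k) / fact (j + k) \<le> z ^ k * (y ^ (j + k) / fact (j + k))"
    by (simp add: power_mult_distrib divide_right_mono mult.commute)
qed

text \<open>The Lagrange form of the remainder at a negative argument: the intermediate point is negative,
  so its exponential \<open>c\<close> is at most \<open>1\<close>.\<close>

lemma exp_tail_neg:
  assumes "x < 0"
  obtains c where "0 \<le> c" "c \<le> 1" "exp_tail k x = c * (x ^ k / fact k)"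
proof (cases "k = 0")
  case True
  then show ?thesis
    using that[of "exp x"] assms by (simp add: exp_tail_def)
next
  case False
  then obtain u where "u < 0" "exp x = (\<Sum>j<k. exp 0 / fact j * x ^ j) + exp u / fact k * x ^ k"
    using Maclaurin_minus[of x k "\<lambda>_. exp" exp] assms by auto
  then show ?thesis
    using that[of "exp u"] by (simp add: exp_tail_def)
qed

text \<open>
  This replaces the elementary fact that \<open>T\<^sub>p x / x ^ p\<close> is increasing, in a form that also
  covers negative \<open>z\<close>. For odd powers the left-hand side is then nonpositive, and for even powers
  it is at most the leading term \<open>(y * z) ^ k / fact k\<close>, which is dominated by \<open>exp_tail k y * z ^ k\<close>.
\<close>

lemma exp_tail_scale:
  assumes "0 \<le> y" "z \<le> 1"
  shows "exp_tail k (y * z) \<le> exp_tail k y * max (z ^ k) 0"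
proof (cases "y = 0 \<or> 0 \<le> z")
  case True
  moreover have "exp_tail k (y * z) \<le> exp_tail k y * max (z ^ k) 0" if "0 \<le> z"
    using exp_tail_scale_unit[of y z k] assms that by (simp add: max_absorb1 mult.commute)
  moreover have "exp_tail k 0 \<le> exp_tail k 0 * max (z ^ k) 0"
    by (cases k) (auto simp: exp_tail_def sum.lessThan_Suc_shift simp del: sum.lessThan_Suc)
  ultimately show ?thesis
    by auto
next
  case False
  then have yz: "0 < y" "z < 0"
    using assms by auto
  then have "y * z < 0"
    by (rule mult_pos_neg)
  then obtain c where c: "0 \<le> c" "c \<le> 1" "exp_tail k (y * z) = c * ((y * z) ^ k / fact k)"
    by (rule exp_tail_neg)
  have "exp_tail k (y * z) = c * (y ^ k / fact k) * z ^ k"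
    by (simp add: c(3) power_mult_distrib)
  also have "\<dots> \<le> c * (y ^ k / fact k) * max (z ^ k) 0"
    using yz c by (intro mult_left_mono) auto
  also have "\<dots> \<le> exp_tail k y * max (z ^ k) 0"
  proof (rule mult_right_mono)
    have "c * (y ^ k / fact k) \<le> 1 * (y ^ k / fact k)"
      using yz c by (intro mult_right_mono) auto
    also have "\<dots> \<le> exp_tail k y"
      using power_le_exp_tail[of y k] yz by simp
    finally show "c * (y ^ k / fact k) \<le> exp_tail k y" .
  qed simp
  finally show ?thesis .
qed

text \<open>Scaling the argument down by \<open>x / y < 1\<close> already gains the factor \<open>(x / y) ^ k < 1\<close>.\<close>

lemma exp_tail_strict_mono:
  assumes "0 \<le> x" "x < y" "0 < k"
  shows "exp_tail k x < exp_tail k y"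
proof -
  have "exp_tail k x \<le> (x / y) ^ k * exp_tail k y"
    using exp_tail_scale_unit[of y "x / y" k] assms by simp
  also have "\<dots> < 1 * exp_tail k y"
    using assms exp_tail_pos[of y k] by (intro mult_strict_right_mono power_Suc_less_one) (auto simp: power_less_one_iff)
  finally show ?thesis by simp
qed

section \<open>The critical equation\<close>

text \<open>
  By Rolle's theorem two solutions for \<open>q\<close> are separated by a solution for the derivative of \<open>q\<close>,
  since \<open>exp\<close> is its own derivative. A solution is therefore determined by the set of solutions
  for \<open>pderiv q\<close> to its left, and induction on the degree shows that there are finitely many of these.
\<close>

lemma finite_poly_eq_exp: "finite {x. poly q x = exp (x::real)}"
proof (induction "degree q" arbitrary: q rule: less_induct)
  case less
  show ?case
  proof (cases "degree q = 0")
    case True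
    then obtain c where "q = [:c:]"
      by (rule degree_eq_zeroE)
    then have "{x. poly q x = exp x} \<subseteq> {ln c}"
      by auto
    then show ?thesis
      by (rule finite_subset) simp
  next
    case False
    define Z where "Z = {x. poly (pderiv q) x = exp (x::real)}"
    have "finite Z"
      unfolding Z_def using False by (intro less) (simp add: degree_pderiv)
    have separated: "\<exists>z\<in>Z. x < z \<and> z < y"
      if "poly q x = exp x" "poly q y = exp y" "x < y" for x y
    proof -
      have deriv: "((\<lambda>x. poly q x - exp x) has_real_derivative (poly (pderiv q) z - exp z)) (at z)" for z
        by (auto intro!: derivative_eq_intros)
      have "\<exists>z>x. z < y \<and> ((\<lambda>x. poly q x - exp x) has_real_derivative 0) (at z)"
      proof (rule Rolle[OF \<open>x < y\<close>])
        show "poly q x - exp x = poly q y - exp y"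
          using that by simp
        show "(\<lambda>x. poly q x - exp x) differentiable (at z)" for z
          using deriv real_differentiable_def by blast
      qed (intro continuous_intros)
      then obtain z where z: "x < z" "z < y"
        "((\<lambda>x. poly q x - exp x) has_real_derivative 0) (at z)" by blast
      from DERIV_unique[OF deriv z(3)] z(1,2) show ?thesis
        by (auto simp: Z_def)
    qed
    have "inj_on (\<lambda>x. Z \<inter> {..<x}) {x. poly q x = exp x}"
    proof (rule linorder_inj_onI')
      fix x y assume "x \<in> {x. poly q x = exp x}" "y \<in> {x. poly q x = exp x}" "x < y"
      then obtain z where "z \<in> Z" "x < z" "z < y"
        using separated[of x y] by auto
      then have "z \<in> Z \<inter> {..<y}" "z \<notin> Z \<inter> {..<x}"
        by auto
      then show "Z \<inter> {..<x} \<noteq> Z \<inter> {..<y}"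
        by blast
    qed
    moreover have "(\<lambda>x. Z \<inter> {..<x}) ` {x. poly q x = exp x} \<subseteq> Pow Z"
      by auto
    ultimately show ?thesis
      using \<open>finite Z\<close> by (meson finite_Pow_iff inj_on_finite)
  qed
qed

lemma finite_G: "finite (G d a)"
proof -
  define q where "q = [:a 0:] - (\<Sum>j = 1..d. monom (a j) j)"
  have "poly q x = a 0 - (\<Sum>j = 1..d. a j * x ^ j)" for x
    by (simp add: q_def poly_sum poly_monom)
  then have "G d a \<subseteq> {x. poly q x = exp x}"
    by (auto simp: G_def)
  then show ?thesis
    using finite_poly_eq_exp by (rule finite_subset)
qed

text \<open>At \<open>0\<close> the polynomial side exceeds \<open>exp\<close>, and for large \<open>x\<close> the exponential wins.\<close>

lemma G_nonempty:
  assumes "1 < a 0"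
  shows "G d a \<noteq> {}"
proof -
  define r where "r x = a 0 - (\<Sum>j = 1..d. a j * x ^ j)" for x
  have "((\<lambda>x. a 0 * (x ^ 0 / exp x) - (\<Sum>j = 1..d. a j * (x ^ j / exp x)))
      \<longlongrightarrow> a 0 * 0 - (\<Sum>j = 1..d. a j * 0)) at_top"
    by (intro tendsto_intros tendsto_power_div_exp_0)
  also have "(\<lambda>x. a 0 * (x ^ 0 / exp x) - (\<Sum>j = 1..d. a j * (x ^ j / exp x)))
      = (\<lambda>x. r x / exp x)"
    by (simp add: r_def diff_divide_distrib sum_divide_distrib)
  finally have "((\<lambda>x. r x / exp x) \<longlongrightarrow> 0) at_top"
    by simp
  then have "\<forall>\<^sub>F x in at_top. r x / exp x < 1"
    by (rule order_tendstoD) simp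
  then have "\<forall>\<^sub>F x in at_top. 0 < x \<and> r x / exp x < 1"
    using eventually_gt_at_top[of 0] by eventually_elim simp
  then obtain c where c: "0 < c" "r c / exp c < 1"
    by (auto dest!: eventually_happens)
  have "r 0 = a 0"
    by (simp add: r_def power_0_left)
  moreover have "continuous_on {0..c} (\<lambda>x. exp x - r x)"
    unfolding r_def by (intro continuous_intros)
  ultimately obtain x where x: "0 \<le> x" "exp x - r x = 0"
    using IVT'[of "\<lambda>x. exp x - r x" 0 0 c] assms c by (auto simp: divide_less_eq)
  have "x \<noteq> 0"
    using x \<open>r 0 = a 0\<close> assms by auto
  then have "x \<in> G d a"
    using x by (simp add: G_def r_def)
  then show ?thesis
    by blast
qed

section \<open>The Chernoff exponent and its critical points\<close>

definition chernoff_exponent :: "nat \<Rightarrow> real \<Rightarrow> (nat \<Rightarrow> real) \<Rightarrow> real \<Rightarrow> real \<Rightarrow> real" where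
  "chernoff_exponent p b m t y =
     - (t / b) * y + (\<Sum>j = 2..p - 1. m j * y ^ j / (b ^ j * fact j)) + m p / b ^ p * exp_tail p y"

text \<open>The derivative in \<open>y\<close> of \<open>chernoff_exponent\<close>, without its constant term \<open>- (t / b)\<close>:
  differentiation lowers the order of an exponential remainder by one.\<close>

definition chernoff_slope :: "nat \<Rightarrow> real \<Rightarrow> (nat \<Rightarrow> real) \<Rightarrow> real \<Rightarrow> real" where
  "chernoff_slope p b m y =
     (\<Sum>j = 1..p - 2. m (j + 1) * y ^ j / (b ^ (j + 1) * fact j)) + m p / b ^ p * exp_tail (p - 1) y"

text \<open>Multiplying the defining equation of \<open>G\<close> by \<open>m p / b ^ p\<close> turns it into the vanishing of the
  derivative of \<open>chernoff_exponent\<close>.\<close>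

lemma mem_G_iff_slope:
  assumes "0 < b" "2 \<le> p" "0 < m p"
  shows "y \<in> G (p - 2) (alpha p b m t) \<longleftrightarrow> 0 < y \<and> chernoff_slope p b m y = t / b"
proof -
  define s where "s = m p / b ^ p"
  have s: "s > 0"
    using assms by (simp add: s_def)
  have head: "s * alpha p b m t 0 = s + t / b"
  proof -
    have "b ^ p = b * b ^ (p - 1)"
      using assms by (metis One_nat_def Suc_1 Suc_leD Suc_pred' less_eq_Suc_le power_Suc)
    then show ?thesis
      using assms by (simp add: s_def alpha_def field_simps)
  qed
  have coeff: "s * alpha p b m t j = m (j + 1) / (b ^ (j + 1) * fact j) - s / fact j"
    if "j \<in> {1..p - 2}" for j
  proof -
    have "p = (p - j - 1) + (j + 1)"
      using that by auto
    then have "b ^ p = b ^ (p - j - 1) * b ^ (j + 1)"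
      by (metis power_add)
    then show ?thesis
      using assms that by (simp add: s_def alpha_def field_simps)
  qed
  have tail: "exp_tail (p - 1) y = exp y - 1 - (\<Sum>j = 1..p - 2. y ^ j / fact j)"
  proof -
    have "{..<p - 1} = insert 0 {1..p - 2}"
      using assms by auto
    then show ?thesis
      by (simp add: exp_tail_def)
  qed
  have "s * (alpha p b m t 0 - (\<Sum>j = 1..p - 2. alpha p b m t j * y ^ j) - exp y)
      = s + t / b - (\<Sum>j = 1..p - 2. (s * alpha p b m t j) * y ^ j) - s * exp y"
    by (simp add: right_diff_distrib head sum_distrib_left mult.assoc)
  also have "(\<Sum>j = 1..p - 2. (s * alpha p b m t j) * y ^ j)
      = (\<Sum>j = 1..p - 2. m (j + 1) * y ^ j / (b ^ (j + 1) * fact j) - s * (y ^ j / fact j))"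
    by (intro sum.cong refl, subst coeff) (auto simp: left_diff_distrib)
  also have "s + t / b - \<dots> - s * exp y = t / b - chernoff_slope p b m y"
    unfolding chernoff_slope_def tail sum_subtractf s_def[symmetric] sum_distrib_left[symmetric]
    by (simp add: algebra_simps)
  finally have "alpha p b m t 0 - (\<Sum>j = 1..p - 2. alpha p b m t j * y ^ j) - exp y = 0
      \<longleftrightarrow> t / b - chernoff_slope p b m y = 0"
    using s by (metis less_irrefl mult_eq_0_iff)
  then show ?thesis
    by (auto simp: G_def)
qed

text \<open>
  Since \<open>T\<^sub>p\<close> and \<open>T\<^sub>p\<^sub>-\<^sub>1\<close> differ by a single monomial, the critical equation expresses the
  transcendental part of \<open>chernoff_exponent\<close> by the polynomial part of \<open>chernoff_slope\<close>.
\<close>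

lemma chernoff_exponent_on_G:
  assumes "0 < b" "2 \<le> p" "0 < m p" "y \<in> G (p - 2) (alpha p b m t)"
  shows "chernoff_exponent p b m t y = bound_exponent p b m t y"
proof -
  define c where "c j = m (j + 1) * y ^ j / (b ^ (j + 1) * fact j)" for j
  obtain q where "p = 2 + q"
    using le_Suc_ex[OF assms(2)] by blast
  then have p: "p = Suc (Suc q)"
    by simp
  have slope: "t / b = (\<Sum>j = 1..q. c j) + m p / b ^ p * exp_tail (Suc q) y"
    using mem_G_iff_slope[of b p m, OF assms(1-3)] assms(4) by (simp add: chernoff_slope_def c_def p)
  have last: "m p / b ^ p * exp_tail p y = m p / b ^ p * exp_tail (Suc q) y - c (Suc q)"
    by (simp add: p exp_tail_Suc c_def right_diff_distrib)
  have split: "(\<Sum>j = 1..q. c j) + c (Suc q) = c 1 + (\<Sum>j = 2..Suc q. c j)"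
    using sum.atLeast_Suc_atMost[of 1 "Suc q" c] by (simp add: numeral_2_eq_2)
  have c1: "c 1 = m 2 / b ^ 2 * y"
    by (simp add: c_def flip: numeral_2_eq_2)
  have "bound_exponent p b m t y = t / b - t / b * y - c 1
      + ((\<Sum>j = 2..p - 1. m j * y ^ j / (b ^ j * fact j)) - (\<Sum>j = 2..Suc q. c j))"
  proof -
    have "(\<Sum>j = 2..p - 1. (m j / (b ^ j * fact j) - m (j + 1) / (b ^ (j + 1) * fact j)) * y ^ j)
        = (\<Sum>j = 2..p - 1. m j * y ^ j / (b ^ j * fact j) - c j)"
      by (simp add: c_def left_diff_distrib)
    then show ?thesis
      unfolding bound_exponent_def c1 by (simp add: p sum_subtractf distrib_right)
  qed
  then show ?thesis
    unfolding chernoff_exponent_def using slope last split by linarith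
qed

lemma chernoff_slope_strict_mono:
  assumes "0 < b" "2 \<le> p" "0 < m p" "\<And>j. j \<in> {2..p - 1} \<Longrightarrow> 0 \<le> m j"
    and "0 < x" "x < y"
  shows "chernoff_slope p b m x < chernoff_slope p b m y"
  unfolding chernoff_slope_def
proof (rule add_le_less_mono)
  show "(\<Sum>j = 1..p - 2. m (j + 1) * x ^ j / (b ^ (j + 1) * fact j))
      \<le> (\<Sum>j = 1..p - 2. m (j + 1) * y ^ j / (b ^ (j + 1) * fact j))"
    using assms by (intro sum_mono divide_right_mono mult_left_mono power_mono) auto
  show "m p / b ^ p * exp_tail (p - 1) x < m p / b ^ p * exp_tail (p - 1) y"
    using assms by (intro mult_strict_left_mono exp_tail_strict_mono) auto
qed

lemma G_singleton:
  assumes "0 < b" "2 \<le> p" "0 < m p" "0 < t" "\<And>j. j \<in> {2..p - 1} \<Longrightarrow> 0 \<le> m j"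
  shows "\<exists>y. G (p - 2) (alpha p b m t) = {y}"
proof -
  have "1 < alpha p b m t 0"
    using assms by (simp add: alpha_def)
  then obtain y where y: "y \<in> G (p - 2) (alpha p b m t)"
    using G_nonempty by blast
  moreover have "x = y" if "x \<in> G (p - 2) (alpha p b m t)" for x
    using that y chernoff_slope_strict_mono[of b p m x y] chernoff_slope_strict_mono[of b p m y x] assms
    by (cases x y rule: linorder_cases) (auto simp: mem_G_iff_slope)
  ultimately show ?thesis
    by blast
qed

section \<open>Moment generating functions and the tail bound\<close>

lemma (in prob_space) mgf_le_moments:
  fixes X :: "'a \<Rightarrow> real"
  assumes [measurable]: "random_variable borel X"
    and le: "AE \<omega> in M. X \<omega> \<le> b" and "0 < b" and int: "integrable M (\<lambda>\<omega>. \<bar>X \<omega>\<bar> ^ p)"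
    and "0 \<le> y"
  shows "integrable M (\<lambda>\<omega>. exp (y / b * X \<omega>))" (is ?int)
    and "\<And>k. k \<le> p \<Longrightarrow> integrable M (\<lambda>\<omega>. X \<omega> ^ k)"
    and "expectation (\<lambda>\<omega>. exp (y / b * X \<omega>))
      \<le> (\<Sum>j<p. (y / b) ^ j / fact j * expectation (\<lambda>\<omega>. X \<omega> ^ j))
        + exp_tail p y / b ^ p * expectation (\<lambda>\<omega>. max (X \<omega> ^ p) 0)" (is "_ \<le> ?R")
proof -
  show ?int
  proof (rule integrable_const_bound)
    show "AE \<omega> in M. norm (exp (y / b * X \<omega>)) \<le> exp (y / b * b)"
      using le by eventually_elim (use assms in \<open>auto intro!: mult_left_mono simp del: times_divide_eq_left\<close>)
  qed simp
  show pow: "integrable M (\<lambda>\<omega>. X \<omega> ^ k)" if "k \<le> p" for k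
  proof (rule Bochner_Integration.integrable_bound)
    show "integrable M (\<lambda>\<omega>. 1 + \<bar>X \<omega>\<bar> ^ p)"
      using int by simp
    have "\<bar>x\<bar> ^ k \<le> 1 + \<bar>x\<bar> ^ p" for x :: real
    proof (cases "\<bar>x\<bar> \<le> 1")
      case True
      then have "\<bar>x\<bar> ^ k \<le> 1" "0 \<le> \<bar>x\<bar> ^ p"
        by (auto intro: power_le_one)
      then show ?thesis by linarith
    next
      case False
      then have "\<bar>x\<bar> ^ k \<le> \<bar>x\<bar> ^ p"
        using that by (intro power_increasing) auto
      then show ?thesis by linarith
    qed
    then show "AE \<omega> in M. norm (X \<omega> ^ k) \<le> norm (1 + \<bar>X \<omega>\<bar> ^ p)"
      by (simp add: power_abs)
  qed simp
  have maxint: "integrable M (\<lambda>\<omega>. max (X \<omega> ^ p) 0)"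
    using pow[of p] by simp
  have "expectation (\<lambda>\<omega>. exp (y / b * X \<omega>))
      \<le> expectation (\<lambda>\<omega>. (\<Sum>j<p. (y / b) ^ j / fact j * X \<omega> ^ j)
            + exp_tail p y / b ^ p * max (X \<omega> ^ p) 0)"
  proof (rule integral_mono_AE[OF \<open>?int\<close>])
    show "integrable M (\<lambda>\<omega>. (\<Sum>j<p. (y / b) ^ j / fact j * X \<omega> ^ j)
            + exp_tail p y / b ^ p * max (X \<omega> ^ p) 0)"
      using pow maxint by (intro Bochner_Integration.integrable_add Bochner_Integration.integrable_sum
          integrable_mult_right) auto
    show "AE \<omega> in M. exp (y / b * X \<omega>) \<le> (\<Sum>j<p. (y / b) ^ j / fact j * X \<omega> ^ j)
            + exp_tail p y / b ^ p * max (X \<omega> ^ p) 0"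
      using le
    proof eventually_elim
      case (elim \<omega>)
      have "exp_tail p (y * (X \<omega> / b)) \<le> exp_tail p y * max ((X \<omega> / b) ^ p) 0"
        using elim assms by (intro exp_tail_scale) auto
      moreover have "max ((X \<omega> / b) ^ p) 0 = max (X \<omega> ^ p) 0 / b ^ p"
        using zero_less_power[OF \<open>0 < b\<close>, of p]
        by (simp add: power_divide max_def divide_le_0_iff)
      ultimately show ?case
        by (simp add: exp_tail_def power_mult_distrib power_divide)
    qed
  qed
  also have "\<dots> = ?R"
  proof -
    have "expectation (\<lambda>\<omega>. \<Sum>j<p. (y / b) ^ j / fact j * X \<omega> ^ j)
        = (\<Sum>j<p. (y / b) ^ j / fact j * expectation (\<lambda>\<omega>. X \<omega> ^ j))"
      by (subst Bochner_Integration.integral_sum) (use pow in auto)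
    moreover have "integrable M (\<lambda>\<omega>. \<Sum>j<p. (y / b) ^ j / fact j * X \<omega> ^ j)"
      by (intro Bochner_Integration.integrable_sum integrable_mult_right pow) simp
    ultimately show ?thesis
      using maxint by simp
  qed
  finally show "expectation (\<lambda>\<omega>. exp (y / b * X \<omega>)) \<le> ?R" .
qed

text \<open>
  The means \<open>expectation (X i)\<close> are kept exactly in the bounds for the single factors, so that they
  cancel against the centring of the sum; only the moments of order at least \<open>2\<close> are replaced by
  upper bounds.
\<close>

lemma (in prob_space) upper_tail_le_chernoff_exponent:
  fixes X :: "nat \<Rightarrow> 'a \<Rightarrow> real" and \<mu> :: "nat \<Rightarrow> nat \<Rightarrow> real"
  assumes "finite I" and indep: "indep_vars (\<lambda>_. borel) X I"
    and "0 < b" "2 \<le> p" "0 < y"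
    and le: "\<And>i. i \<in> I \<Longrightarrow> AE \<omega> in M. X i \<omega> \<le> b"
    and int: "\<And>i. i \<in> I \<Longrightarrow> integrable M (\<lambda>\<omega>. \<bar>X i \<omega>\<bar> ^ p)"
    and mom: "\<And>i k. i \<in> I \<Longrightarrow> k \<in> {2..p - 1} \<Longrightarrow> expectation (\<lambda>\<omega>. X i \<omega> ^ k) \<le> \<mu> i k"
    and top: "\<And>i. i \<in> I \<Longrightarrow> expectation (\<lambda>\<omega>. max (X i \<omega> ^ p) 0) \<le> \<mu> i p"
  shows "prob {\<omega> \<in> space M. (\<Sum>i\<in>I. X i \<omega>) - expectation (\<lambda>\<omega>. \<Sum>i\<in>I. X i \<omega>) \<ge> t}
    \<le> exp (chernoff_exponent p b (\<lambda>k. \<Sum>i\<in>I. \<mu> i k) t y)"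
proof -
  define s where "s = y / b"
  define ES where "ES = expectation (\<lambda>\<omega>. \<Sum>i\<in>I. X i \<omega>)"
  define w where "w i = (\<Sum>j = 2..p - 1. \<mu> i j * y ^ j / (b ^ j * fact j)) + \<mu> i p / b ^ p * exp_tail p y"
    for i
  have s: "0 < s"
    using assms by (simp add: s_def)
  have rv [measurable]: "random_variable borel (X i)" if "i \<in> I" for i
    using indep that by (simp add: indep_vars_def)
  note mgf = mgf_le_moments[OF rv le \<open>0 < b\<close> int less_imp_le[OF \<open>0 < y\<close>]]
  have intX: "integrable M (X i)" if "i \<in> I" for i
    using mgf(2)[OF that that that, of 1] assms by simp
  have single: "expectation (\<lambda>\<omega>. exp (s * X i \<omega>)) \<le> exp (s * expectation (X i) + w i)"
    if i: "i \<in> I" for i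
  proof -
    have idx: "{..<p} = insert 0 (insert 1 {2..p - 1})"
      using \<open>2 \<le> p\<close> by auto
    have "expectation (\<lambda>\<omega>. exp (s * X i \<omega>))
      \<le> (\<Sum>j<p. s ^ j / fact j * expectation (\<lambda>\<omega>. X i \<omega> ^ j))
        + exp_tail p y / b ^ p * expectation (\<lambda>\<omega>. max (X i \<omega> ^ p) 0)"
      using mgf(3)[OF i i i] by (simp add: s_def)
    also have "(\<Sum>j<p. s ^ j / fact j * expectation (\<lambda>\<omega>. X i \<omega> ^ j))
        = 1 + s * expectation (X i) + (\<Sum>j = 2..p - 1. s ^ j / fact j * expectation (\<lambda>\<omega>. X i \<omega> ^ j))"
      unfolding idx by (simp add: prob_space)
    also have "(\<Sum>j = 2..p - 1. s ^ j / fact j * expectation (\<lambda>\<omega>. X i \<omega> ^ j))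
        \<le> (\<Sum>j = 2..p - 1. s ^ j / fact j * \<mu> i j)"
      using mom i s by (intro sum_mono mult_left_mono) auto
    also have "(\<Sum>j = 2..p - 1. s ^ j / fact j * \<mu> i j)
        = (\<Sum>j = 2..p - 1. \<mu> i j * y ^ j / (b ^ j * fact j))"
      by (simp add: s_def power_divide mult.commute)
    also have "exp_tail p y / b ^ p * expectation (\<lambda>\<omega>. max (X i \<omega> ^ p) 0)
        \<le> exp_tail p y / b ^ p * \<mu> i p"
      using top i exp_tail_pos[of y p] assms by (intro mult_left_mono) auto
    finally have "expectation (\<lambda>\<omega>. exp (s * X i \<omega>)) \<le> 1 + (s * expectation (X i) + w i)"
      by (simp add: w_def mult.commute)
    also have "\<dots> \<le> exp (s * expectation (X i) + w i)"
      by (rule exp_ge_add_one_self)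
    finally show ?thesis .
  qed
  have indep': "indep_vars (\<lambda>_. borel) (\<lambda>i \<omega>. exp (s * X i \<omega>)) I"
    by (rule indep_vars_compose2[OF indep]) simp
  have intE: "integrable M (\<lambda>\<omega>. exp (s * X i \<omega>))" if "i \<in> I" for i
    using mgf(1)[OF that that that] by (simp add: s_def)
  have prodE: "(\<Prod>i\<in>I. exp (s * X i \<omega>)) = exp (s * (\<Sum>i\<in>I. X i \<omega>))" for \<omega>
    by (simp add: sum_distrib_left exp_sum \<open>finite I\<close>)
  have intS: "integrable M (\<lambda>\<omega>. exp (s * (\<Sum>i\<in>I. X i \<omega>)))"
    using indep_vars_integrable[OF \<open>finite I\<close> indep' intE] by (simp add: prodE)
  have "expectation (\<lambda>\<omega>. exp (s * (\<Sum>i\<in>I. X i \<omega>))) = (\<Prod>i\<in>I. expectation (\<lambda>\<omega>. exp (s * X i \<omega>)))"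
    using indep_vars_lebesgue_integral[OF \<open>finite I\<close> indep' intE] by (simp add: prodE)
  also have "\<dots> \<le> (\<Prod>i\<in>I. exp (s * expectation (X i) + w i))"
    using single by (intro prod_mono) (auto intro!: Bochner_Integration.integral_nonneg)
  also have "\<dots> = exp (s * ES + (\<Sum>i\<in>I. w i))"
    using intX by (simp add: ES_def exp_sum[symmetric] \<open>finite I\<close> sum.distrib sum_distrib_left)
  finally have mgfS: "expectation (\<lambda>\<omega>. exp (s * (\<Sum>i\<in>I. X i \<omega>))) \<le> exp (s * ES + (\<Sum>i\<in>I. w i))" .
  have "s * (t + ES) \<le> s * x \<longleftrightarrow> t \<le> x - ES" for x
    using s by (simp add: le_diff_eq)
  then have "{\<omega> \<in> space M. (\<Sum>i\<in>I. X i \<omega>) - ES \<ge> t}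
      = {\<omega> \<in> space M. exp (s * (\<Sum>i\<in>I. X i \<omega>)) \<ge> exp (s * (t + ES))}"
    by simp
  then have "prob {\<omega> \<in> space M. (\<Sum>i\<in>I. X i \<omega>) - ES \<ge> t}
      \<le> expectation (\<lambda>\<omega>. exp (s * (\<Sum>i\<in>I. X i \<omega>))) / exp (s * (t + ES))"
    using integral_Markov_inequality_measure[OF intS, of "{}" "exp (s * (t + ES))"] by simp
  also have "\<dots> \<le> exp (s * ES + (\<Sum>i\<in>I. w i)) / exp (s * (t + ES))"
    using mgfS by (intro divide_right_mono) auto
  also have "\<dots> = exp (- (s * t) + (\<Sum>i\<in>I. w i))"
    by (simp add: algebra_simps flip: exp_diff)
  also have "(\<Sum>i\<in>I. w i) = (\<Sum>j = 2..p - 1. (\<Sum>i\<in>I. \<mu> i j) * y ^ j / (b ^ j * fact j))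
      + (\<Sum>i\<in>I. \<mu> i p) / b ^ p * exp_tail p y"
    unfolding w_def sum.distrib
    by (subst sum.swap) (simp add: sum_distrib_right sum_divide_distrib)
  finally show ?thesis
    by (simp add: chernoff_exponent_def ES_def s_def algebra_simps)
qed

section \<open>The Lambert function\<close>

lemma lambert_W_eqI:
  assumes "0 \<le> w" "w * exp w = x"
  shows "lambert_W x = w"
  unfolding lambert_W_def
proof (rule the1_equality[OF lambert_W_unique_exists])
  show "0 \<le> x"
    using assms by (auto intro: mult_nonneg_nonneg)
qed (use assms in simp)

text \<open>Substituting \<open>w = a / c - x\<close> turns the equation into \<open>w * exp w = exp (a / c) / c\<close>; the sign of \<open>c\<close>
  makes \<open>w\<close> positive and so selects the principal branch.\<close>

lemma linear_eq_exp_lambert_W: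
  fixes a c x :: real
  assumes "0 < c" "a - c * x = exp x"
  shows "x = a / c - lambert_W (exp (a / c) / c)"
proof -
  have w: "a / c - x = exp x / c"
    using assms by (simp add: field_simps)
  have "lambert_W (exp (a / c) / c) = a / c - x"
  proof (rule lambert_W_eqI)
    show "0 \<le> a / c - x"
      using assms w by simp
    show "(a / c - x) * exp (a / c - x) = exp (a / c) / c"
      unfolding exp_diff by (simp add: w)
  qed
  then show ?thesis by simp
qed

section \<open>The generalised Bennett inequality\<close>

theorem theorem3:
  fixes M :: "'a measure" and X :: "nat \<Rightarrow> 'a \<Rightarrow> real" and \<mu> :: "nat \<Rightarrow> nat \<Rightarrow> real"
    and n p :: nat and b t :: real
  defines "S \<equiv> \<lambda>\<omega>. \<Sum>i = 1..n. X i \<omega>"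
    and "m \<equiv> \<lambda>k. \<Sum>i = 1..n. \<mu> i k"
  assumes "prob_space M"
    and "0 < b" and "2 \<le> p" and "1 \<le> n" and "0 < t"
    and "prob_space.indep_vars M (\<lambda>_. borel) X {1..n}"
    and "\<And>i. i \<in> {1..n} \<Longrightarrow> measure M {\<omega> \<in> space M. X i \<omega> \<in> {..b}} = 1"
    and "\<And>i. i \<in> {1..n} \<Longrightarrow> integrable M (\<lambda>\<omega>. \<bar>X i \<omega>\<bar> ^ p)"
    and "\<And>i. i \<in> {1..n} \<Longrightarrow> \<mu> i 1 = (\<integral>\<omega>. X i \<omega> \<partial>M)"
    and "\<And>i k. i \<in> {1..n} \<Longrightarrow> k \<in> {1..p - 1} \<Longrightarrow> (\<integral>\<omega>. X i \<omega> ^ k \<partial>M) \<le> \<mu> i k"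
    and "\<And>i. i \<in> {1..n} \<Longrightarrow> 0 < (\<integral>\<omega>. max (X i \<omega> ^ p) 0 \<partial>M)"
    and "\<And>i. i \<in> {1..n} \<Longrightarrow> (\<integral>\<omega>. max (X i \<omega> ^ p) 0 \<partial>M) \<le> \<mu> i p"
  defines "\<alpha> \<equiv> alpha p b m t"
    and "f \<equiv> bound_exponent p b m t"
    and "P \<equiv> measure M {\<omega> \<in> space M. S \<omega> - (\<integral>\<omega>'. S \<omega>' \<partial>M) \<ge> t}"
  shows
    "(\<alpha> 0 > 1 \<and> finite (G (p - 2) \<alpha>) \<and> G (p - 2) \<alpha> \<noteq> {}
       \<and> P \<le> exp (Max (f ` G (p - 2) \<alpha>)))
     \<and> ((\<forall>j. odd j \<and> 3 \<le> j \<and> j \<le> p - 1 \<longrightarrow> 0 \<le> m j) \<longrightarrow>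
       (\<exists>y. G (p - 2) \<alpha> = {y} \<and> exp (Max (f ` G (p - 2) \<alpha>)) = exp (f y) \<and> P \<le> exp (f y)))
     \<and> (p = 2 \<longrightarrow>
       G 0 \<alpha> = {ln (\<alpha> 0)}
       \<and> exp (Max (f ` G 0 \<alpha>)) = exp (t / b - (t / b + m 2 / b ^ 2) * ln (t * b / m 2 + 1))
       \<and> P \<le> exp (t / b - (t / b + m 2 / b ^ 2) * ln (t * b / m 2 + 1))
       \<and> exp (t / b - (t / b + m 2 / b ^ 2) * ln (t * b / m 2 + 1))
         = exp (- (m 2 / b ^ 2) * ((b * t / m 2 + 1) * ln (b * t / m 2 + 1) - b * t / m 2)))
     \<and> (p = 3 \<and> \<alpha> 1 \<noteq> 0 \<and> (\<forall>i\<in>{1..n}. (\<integral>\<omega>. max (X i \<omega> ^ 3) 0 \<partial>M) = \<mu> i 3) \<longrightarrow>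
       (let y = \<alpha> 0 / \<alpha> 1 - lambert_W (exp (\<alpha> 0 / \<alpha> 1) / \<alpha> 1);
            B = exp (t / b - (t / b + m 2 / b ^ 2) * y
                     + (m 2 / (2 * b ^ 2) - m 3 / (2 * b ^ 3)) * y ^ 2)
        in G 1 \<alpha> = {y} \<and> exp (Max (f ` G 1 \<alpha>)) = B \<and> P \<le> B))"
proof -
  interpret prob_space M by (rule assms(3))
  note pos = \<open>0 < b\<close> \<open>2 \<le> p\<close>
  have le_b: "AE \<omega> in M. X i \<omega> \<le> b" if "i \<in> {1..n}" for i
    using AE_prob_1[OF assms(9)[OF that]] by eventually_elim simp
  have "0 < \<mu> i p" if "i \<in> {1..n}" for i
    using assms(13,14)[OF that] by linarith
  then have mp: "0 < m p"
    unfolding m_def using \<open>1 \<le> n\<close> by (intro sum_pos) auto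
  have \<alpha>0: "1 < \<alpha> 0"
    using pos mp \<open>0 < t\<close> by (simp add: \<alpha>_def alpha_def)
  have fin: "finite (G (p - 2) \<alpha>)" and ne: "G (p - 2) \<alpha> \<noteq> {}"
    using finite_G G_nonempty \<alpha>0 by auto
  \<comment> \<open>The bound holds at each critical point separately, so it holds in particular at the worst one.\<close>
  have P_le: "P \<le> exp (f y)" if y: "y \<in> G (p - 2) \<alpha>" for y
  proof -
    have "P \<le> exp (chernoff_exponent p b m t y)"
      unfolding P_def S_def m_def
      by (rule upper_tail_le_chernoff_exponent)
        (use assms le_b y in \<open>auto simp: G_def\<close>)
    then show ?thesis
      using chernoff_exponent_on_G[of b p m, OF pos mp] y by (simp add: f_def \<alpha>_def)
  qed
  have "Max (f ` G (p - 2) \<alpha>) \<in> f ` G (p - 2) \<alpha>"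
    using fin ne by (intro Max_in) auto
  then have i: "P \<le> exp (Max (f ` G (p - 2) \<alpha>))"
    using P_le by auto
  have even_nonneg: "0 \<le> m j" if "even j" "j \<in> {2..p - 1}" for j
    unfolding m_def
  proof (rule sum_nonneg)
    fix i assume "i \<in> {1..n}"
    moreover have "0 \<le> (\<integral>\<omega>. X i \<omega> ^ j \<partial>M)"
      using that by (intro Bochner_Integration.integral_nonneg) (auto simp: zero_le_even_power)
    ultimately show "0 \<le> \<mu> i j"
      using assms(12)[of i j] that by auto
  qed
  have ii: "\<exists>y. G (p - 2) \<alpha> = {y}" if odd: "\<forall>j. odd j \<and> 3 \<le> j \<and> j \<le> p - 1 \<longrightarrow> 0 \<le> m j"
    unfolding \<alpha>_def
  proof (rule G_singleton[of b p m, OF pos mp \<open>0 < t\<close>])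
    fix j assume j: "j \<in> {2..p - 1}"
    show "0 \<le> m j"
    proof (cases "even j")
      case True
      then show ?thesis
        using even_nonneg j by simp
    next
      case False
      then have "3 \<le> j"
        using j by (cases "j = 2") auto
      then show ?thesis
        using odd False j by auto
    qed
  qed
  have iii: "G 0 \<alpha> = {ln (\<alpha> 0)}"
      "f (ln (\<alpha> 0)) = t / b - (t / b + m 2 / b ^ 2) * ln (t * b / m 2 + 1)"
      "t / b - (t / b + m 2 / b ^ 2) * ln (t * b / m 2 + 1)
        = - (m 2 / b ^ 2) * ((b * t / m 2 + 1) * ln (b * t / m 2 + 1) - b * t / m 2)"
    if "p = 2"
  proof -
    show "G 0 \<alpha> = {ln (\<alpha> 0)}"
      using \<alpha>0 by (auto simp: G_def)
    show "f (ln (\<alpha> 0)) = t / b - (t / b + m 2 / b ^ 2) * ln (t * b / m 2 + 1)"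
      by (simp add: f_def bound_exponent_def \<alpha>_def alpha_def that add.commute)
    show "t / b - (t / b + m 2 / b ^ 2) * ln (t * b / m 2 + 1)
        = - (m 2 / b ^ 2) * ((b * t / m 2 + 1) * ln (b * t / m 2 + 1) - b * t / m 2)"
      using pos mp that by (simp add: mult.commute[of t b]) (simp add: field_simps power2_eq_square)
  qed
  have iv: "G 1 \<alpha> = {\<alpha> 0 / \<alpha> 1 - lambert_W (exp (\<alpha> 0 / \<alpha> 1) / \<alpha> 1)}"
    if p: "p = 3" and ne0: "\<alpha> 1 \<noteq> 0"
      and eq: "\<forall>i\<in>{1..n}. (\<integral>\<omega>. max (X i \<omega> ^ 3) 0 \<partial>M) = \<mu> i 3"
  proof -
    \<comment> \<open>With equality in the third moments, \<open>X ^ 3 \<le> b * X ^ 2\<close> gives \<open>m 3 \<le> b * m 2\<close>,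
      that is \<open>\<alpha> 1 \<ge> 0\<close>: the argument of \<open>lambert_W\<close> is positive.\<close>
    have "\<mu> i 3 \<le> b * \<mu> i 2" if i: "i \<in> {1..n}" for i
    proof -
      have rv: "random_variable borel (X i)"
        using assms(8) i by (simp add: indep_vars_def)
      note int = mgf_le_moments(2)[OF rv le_b[OF i] pos(1) assms(10)[OF i] order_refl]
      have "(\<integral>\<omega>. max (X i \<omega> ^ 3) 0 \<partial>M) \<le> (\<integral>\<omega>. b * X i \<omega> ^ 2 \<partial>M)"
      proof (rule integral_mono_AE)
        show "AE \<omega> in M. max (X i \<omega> ^ 3) 0 \<le> b * X i \<omega> ^ 2"
          using le_b[OF i]
        proof eventually_elim
          case (elim \<omega>)
          then have "X i \<omega> * X i \<omega> ^ 2 \<le> b * X i \<omega> ^ 2"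
            by (intro mult_right_mono) auto
          then show ?case
            using pos by (simp add: power3_eq_cube power2_eq_square mult.assoc)
        qed
      qed (use int[of 3] int[of 2] p in auto)
      also have "\<dots> = b * (\<integral>\<omega>. X i \<omega> ^ 2 \<partial>M)"
        by simp
      also have "\<dots> \<le> b * \<mu> i 2"
        using assms(12)[OF i, of 2] pos p by (intro mult_left_mono) auto
      finally show ?thesis
        using eq i by simp
    qed
    then have "m 3 \<le> b * m 2"
      by (auto simp: m_def sum_distrib_left intro!: sum_mono)
    then have "0 \<le> \<alpha> 1"
      using mp p by (simp add: \<alpha>_def alpha_def numeral_2_eq_2[symmetric])
    then have "0 < \<alpha> 1"
      using ne0 by simp
    have "x = \<alpha> 0 / \<alpha> 1 - lambert_W (exp (\<alpha> 0 / \<alpha> 1) / \<alpha> 1)" if "x \<in> G 1 \<alpha>" for x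
      using that \<open>0 < \<alpha> 1\<close> by (intro linear_eq_exp_lambert_W) (auto simp: G_def)
    moreover have "G 1 \<alpha> \<noteq> {}"
      using ne p by simp
    ultimately show ?thesis
      by blast
  qed
  have f3: "f y = t / b - (t / b + m 2 / b ^ 2) * y + (m 2 / (2 * b ^ 2) - m 3 / (2 * b ^ 3)) * y ^ 2"
    if "p = 3" for y
    by (simp add: that f_def bound_exponent_def mult.commute)
  show ?thesis
  proof (intro conjI impI)
    assume "\<forall>j. odd j \<and> 3 \<le> j \<and> j \<le> p - 1 \<longrightarrow> 0 \<le> m j"
    from ii[OF this] obtain y where "G (p - 2) \<alpha> = {y}" ..
    then show "\<exists>y. G (p - 2) \<alpha> = {y} \<and> exp (Max (f ` G (p - 2) \<alpha>)) = exp (f y) \<and> P \<le> exp (f y)"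
      using P_le by auto
  next
    assume "p = 2"
    from iii[OF this] \<open>p = 2\<close> i show "P \<le> exp (t / b - (t / b + m 2 / b ^ 2) * ln (t * b / m 2 + 1))"
      by simp
  next
    assume "p = 3 \<and> \<alpha> 1 \<noteq> 0 \<and> (\<forall>i\<in>{1..n}. (\<integral>\<omega>. max (X i \<omega> ^ 3) 0 \<partial>M) = \<mu> i 3)"
    then have p: "p = 3" and G1: "G 1 \<alpha> = {\<alpha> 0 / \<alpha> 1 - lambert_W (exp (\<alpha> 0 / \<alpha> 1) / \<alpha> 1)}"
      using iv by auto
    show "let y = \<alpha> 0 / \<alpha> 1 - lambert_W (exp (\<alpha> 0 / \<alpha> 1) / \<alpha> 1);
            B = exp (t / b - (t / b + m 2 / b ^ 2) * y
                     + (m 2 / (2 * b ^ 2) - m 3 / (2 * b ^ 3)) * y ^ 2)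
        in G 1 \<alpha> = {y} \<and> exp (Max (f ` G 1 \<alpha>)) = B \<and> P \<le> B"
      using P_le G1 p unfolding Let_def f3[OF p, symmetric] by simp
  qed (use \<alpha>0 fin ne i iii in simp_all)
qed

end
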